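(* Let $\lambda^*$ be the minimum scaled sparsest cut of $G$, i.e. $\lambda^* = \min_{\emptyset \neq S \subsetneq V} \psi(S)$, where $\psi(S) = \mathrm{cut}(S)/(|S||\bar S|)$ and $\mathrm{cut}(S)$ denotes the number of edges of $G$ with one endpoint in $S$ and the other in $\bar S = V\setminus S$. (a) For all $\lambda > \lambda^*$, an optimal solution of the standard LambdaCC objective partitions $G$ into two or more clusters, each of which has scaled sparsest cut $\leq \lambda$. Moreover, there exists some $\lambda' > \lambda^*$ such that the optimal clustering for standard LambdaCC is the minimum sparsest cut partition $\{S^*, \bar S^*\}$. (b) For $\lambda \leq \lambda^*$, it is optimal to place all nodes into a single cluster.
   Context: Let $G=(V,E)$ be an undirected, unweighted graph on $n$ nodes. For $S \subseteq V$, $\bar S = V \setminus S$, and for disjoint $S,T\subseteq V$, $\mathrm{cut}(S,T)$ is the number of edges between $S$ and $T$, with $\mathrm{cut}(S)=\mathrm{cut}(S,\bar S)$. The standard LambdaCC objective, for a resolution parameter $\lambda\in(0,1)$, is: over all clusterings of $V$ encoded by binary distances $x_{ij}$ ($x_{ij}=0$ if $i,j$ are in the same cluster, $1$ otherwise, satisfying triangle inequalities $x_{ij}\le x_{ik}+x_{jk}$), minimize $\sum_{(i,j)\in E}(1-\lambda)x_{ij} + \sum_{(i,j)\notin E}\lambda(1-x_{ij})$. Equivalently, over clusterings $\{S_1,\dots,S_k\}$ (with $k$ not fixed), minimize $\frac12\sum_{i=1}^k \mathrm{cut}(S_i) - \frac{\lambda}{2}\sum_{i=1}^k |S_i||\bar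 S_i| + \lambda\binom{n}{2} - \lambda|E|$. The scaled sparsest cut of $S$ is $\psi(S)=\mathrm{cut}(S)/(|S||\bar S|)$.
   Formalization: The "Moreover" clause fails in general (e.g. three isolated vertices), so it is proved only when λ* < 1 and V has no partition into three or more sets all of scaled sparsest cut λ*; S* need not be unique, |V| ≥ 2, and λ, λ' range over (0,1). *)

theory Defs
  imports Complex_Main "HOL-Library.Disjoint_Sets"
begin

definition all_pairs :: "'a set \<Rightarrow> 'a set set" where
  "all_pairs V = {e. e \<subseteq> V \<and> card e = 2}"

definition simple_graph :: "'a set \<Rightarrow> 'a set set \<Rightarrow> bool" where
  "simple_graph V E \<longleftrightarrow> finite V \<and> E \<subseteq> all_pairs V"

definition cut_between :: "'a set set \<Rightarrow> 'a set \<Rightarrow> 'a set \<Rightarrow> nat" where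
  "cut_between E S T = card {e \<in> E. \<exists>i\<in>S. \<exists>j\<in>T. e = {i, j}}"

definition cut :: "'a set \<Rightarrow> 'a set set \<Rightarrow> 'a set \<Rightarrow> nat" where
  "cut V E S = cut_between E S (V - S)"

definition scaled_cut :: "'a set \<Rightarrow> 'a set set \<Rightarrow> 'a set \<Rightarrow> real" where
  "scaled_cut V E S = real (cut V E S) / (real (card S) * real (card (V - S)))"

text \<open>The minimum ranges over a nonempty family only if \<open>V\<close> has at least two elements.\<close>

definition min_scaled_cut :: "'a set \<Rightarrow> 'a set set \<Rightarrow> real" where
  "min_scaled_cut V E = Min (scaled_cut V E ` {S. S \<noteq> {} \<and> S \<subset> V})"

definition is_min_scaled_cut :: "'a set \<Rightarrow> 'a set set \<Rightarrow> 'a set \<Rightarrow> bool" where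
  "is_min_scaled_cut V E S \<longleftrightarrow>
     S \<noteq> {} \<and> S \<subset> V \<and> scaled_cut V E S = min_scaled_cut V E"

text \<open>A clustering of \<open>V\<close> is a \<open>C\<close> with \<^term>\<open>partition_on V C\<close>. Its binary distance
  \<open>x\<^sub>i\<^sub>j\<close> is evaluated at the unordered pair \<open>e = {i, j}\<close>, so that each pair of nodes
  contributes exactly once to the objective.\<close>

definition cluster_dist :: "'a set set \<Rightarrow> 'a set \<Rightarrow> real" where
  "cluster_dist C e = (if \<exists>S\<in>C. e \<subseteq> S then 0 else 1)"

definition lambda_cc :: "'a set \<Rightarrow> 'a set set \<Rightarrow> real \<Rightarrow> 'a set set \<Rightarrow> real" where
  "lambda_cc V E l C =
     (\<Sum>e\<in>E. (1 - l) * cluster_dist C e)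
   + (\<Sum>e\<in>all_pairs V - E. l * (1 - cluster_dist C e))"

definition lambda_cc_optimal :: "'a set \<Rightarrow> 'a set set \<Rightarrow> real \<Rightarrow> 'a set set \<Rightarrow> bool" where
  "lambda_cc_optimal V E l C \<longleftrightarrow>
     partition_on V C \<and> (\<forall>D. partition_on V D \<longrightarrow> lambda_cc V E l C \<le> lambda_cc V E l D)"

end

theory Submission
  imports Defs
begin

text \<open>
  For a clustering \<open>C\<close> the objective equals a constant plus
  \<open>\<Sum>\<^bsub>S \<in> C\<^esub> (cut(S) - \<lambda> |S| |V - S|) / 2\<close>. All possible summands are nonnegative iff \<open>\<lambda> \<le> \<lambda>\<^sup>*\<close>, which
  makes the single cluster optimal exactly up to \<open>\<lambda>\<^sup>*\<close>. A cluster \<open>S\<close> with a positive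
  summand is, on average, joined too densely to the other clusters, so merging it with one of them
  improves the objective. At \<open>\<lambda> = \<lambda>\<^sup>*\<close> the sum vanishes only for \<open>{V}\<close> and for partitions into minimum
  cuts; as there are finitely many partitions, slightly above \<open>\<lambda>\<^sup>*\<close> every other partition
  still has a positive sum while a minimum cut has a negative one.
\<close>

section \<open>Edge counts between disjoint node sets\<close>

lemma finite_all_pairs: "finite V \<Longrightarrow> finite (all_pairs V)"
  unfolding all_pairs_def by (rule finite_subset[of _ "Pow V"]) auto

lemma cut_between_commute: "cut_between F S T = cut_between F T S"
  unfolding cut_between_def by (rule arg_cong[where f = card]) (auto simp: insert_commute)

lemma cut_between_Un_right:
  assumes "finite F" "S \<inter> T = {}" "T \<inter> U = {}"
  shows "cut_between F S (T \<union> U) = cut_between F S T + cut_between F S U"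
proof -
  let ?c = "\<lambda>T. {e \<in> F. \<exists>i\<in>S. \<exists>j\<in>T. e = {i, j}}"
  have "?c (T \<union> U) = ?c T \<union> ?c U" by auto
  \<comment> \<open>Suppose \<open>{i, j} = {i', j'}\<close> with \<open>i\<close>,
    \<open>i'\<close> in \<open>S\<close>, \<open>j\<close> in \<open>T\<close> and
    \<open>j'\<close> in \<open>U\<close>. Either \<open>j = j'\<close>, against
    \<open>T \<inter> U = {}\<close>, or \<open>j = i'\<close> lies in \<open>S\<close>, against
    \<open>S \<inter> T = {}\<close>.\<close>
  moreover have "?c T \<inter> ?c U = {}"
    using assms(2,3) by (auto simp: doubleton_eq_iff)
  moreover have "finite (?c T)" "finite (?c U)" using assms(1) by auto
  ultimately show ?thesis
    unfolding cut_between_def by (metis (no_types, lifting) card_Un_disjoint)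
qed

lemma cut_between_Union_right:
  assumes "finite F" "finite D" "disjoint D" "\<And>T. T \<in> D \<Longrightarrow> S \<inter> T = {}"
  shows "cut_between F S (\<Union>D) = (\<Sum>T\<in>D. cut_between F S T)"
  using assms(2,3,4)
proof (induction D rule: finite_induct)
  case empty
  then show ?case by (simp add: cut_between_def)
next
  case (insert T D)
  have "T \<inter> \<Union>D = {}"
    using insert.hyps insert.prems(1) by (auto simp: disjoint_def)
  moreover have "disjoint D" using insert.prems(1) by (auto simp: disjoint_def)
  ultimately show ?case
    using insert cut_between_Un_right[OF assms(1), of S T "\<Union>D"] by simp
qed

text \<open>Products of cluster sizes are cut values of the complete graph. Hence an identity proved
  for cuts of an arbitrary edge set \<open>F\<close> yields, besides the edge term
  (\<open>F = E\<close>), the quadratic term of the objective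
  (\<open>F = all_pairs V\<close>).\<close>

lemma cut_between_all_pairs:
  assumes "S \<subseteq> V" "T \<subseteq> V" "S \<inter> T = {}"
  shows "cut_between (all_pairs V) S T = card S * card T"
proof -
  have "{e \<in> all_pairs V. \<exists>i\<in>S. \<exists>j\<in>T. e = {i, j}} = (\<lambda>(i, j). {i, j}) ` (S \<times> T)"
  proof -
    have "card {i, j} = 2" if "i \<in> S" "j \<in> T" for i j
      using assms(3) that by (metis card_2_iff disjoint_iff)
    then show ?thesis using assms by (auto simp: all_pairs_def)
  qed
  moreover have "inj_on (\<lambda>(i, j). {i, j}) (S \<times> T)"
    using assms(3) by (auto simp: inj_on_def doubleton_eq_iff)
  ultimately show ?thesis
    unfolding cut_between_def by (simp add: card_image card_cartesian_product)
qed

lemma cut_all_pairs: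
  "S \<subseteq> V \<Longrightarrow> cut V (all_pairs V) S = card S * card (V - S)"
  unfolding cut_def by (rule cut_between_all_pairs) auto

section \<open>The objective as a sum over clusters\<close>

lemma card_crossing_clusters:
  assumes "partition_on V C" "e \<in> all_pairs V"
  shows "real (card {S \<in> C. \<exists>i\<in>S. \<exists>j\<in>V - S. e = {i, j}}) = 2 * cluster_dist C e"
proof -
  obtain i j where e: "e = {i, j}" "i \<noteq> j" "i \<in> V" "j \<in> V"
    using assms(2) by (auto simp: all_pairs_def card_2_iff)
  obtain A B where AB: "A \<in> C" "i \<in> A" "B \<in> C" "j \<in> B"
    using assms(1) e by (auto simp: partition_on_def)
  have unique: "S = T" if "S \<in> C" "T \<in> C" "x \<in> S" "x \<in> T" for S T x
    using assms(1) that by (auto simp: partition_on_def disjoint_def)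
  \<comment> \<open>A cluster that \<open>e\<close> crosses contains exactly one endpoint, so it is
    exactly one of \<open>A\<close> and \<open>B\<close>. This gives no such cluster if
    \<open>A = B\<close> and the two clusters \<open>A\<close>, \<open>B\<close> otherwise.\<close>
  have cross: "(S = A) \<noteq> (S = B)" if "S \<in> C" "\<exists>i\<in>S. \<exists>j\<in>V - S. e = {i, j}" for S
    using that AB e(1) unique[of S A i] unique[of S B j] by (auto simp: doubleton_eq_iff)
  show ?thesis
  proof (cases "A = B")
    case True
    then have empty: "{S \<in> C. \<exists>i\<in>S. \<exists>j\<in>V - S. e = {i, j}} = {}"
      using cross by blast
    have "cluster_dist C e = 0"
      using True AB e(1) by (auto simp: cluster_dist_def)
    then show ?thesis unfolding empty by simp
  next
    case False
    then have "i \<notin> B" "j \<notin> A" using AB unique by blast+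
    then have "\<exists>i\<in>A. \<exists>j\<in>V - A. e = {i, j}" "\<exists>i\<in>B. \<exists>j\<in>V - B. e = {i, j}"
      using AB e by (blast intro: insert_commute)+
    then have AB_only: "{S \<in> C. \<exists>i\<in>S. \<exists>j\<in>V - S. e = {i, j}} = {A, B}"
      using cross AB by blast
    have "\<not> (\<exists>S\<in>C. e \<subseteq> S)"
      using e(1) AB \<open>j \<notin> A\<close> unique by blast
    then show ?thesis unfolding AB_only using False by (simp add: cluster_dist_def)
  qed
qed

text \<open>Double counting of the incidences between clusters and edges leaving them: a separated
  pair leaves two clusters, any other pair none.\<close>

lemma sum_cut_partition:
  assumes "finite V" "partition_on V C" "F \<subseteq> all_pairs V"
  shows "(\<Sum>S\<in>C. real (cut V F S)) = 2 * (\<Sum>e\<in>F. cluster_dist C e)"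
proof -
  have F: "finite F" using assms finite_all_pairs finite_subset by blast
  have C: "finite C" using assms(1,2) by (rule finite_elements)
  let ?X = "\<lambda>S e. \<exists>i\<in>S. \<exists>j\<in>V - S. e = {i, j}"
  have "(\<Sum>S\<in>C. real (cut V F S)) = (\<Sum>S\<in>C. \<Sum>e\<in>F. if ?X S e then 1 else 0)"
    unfolding cut_def cut_between_def using F by (simp add: sum.If_cases Int_def)
  also have "\<dots> = (\<Sum>e\<in>F. \<Sum>S\<in>C. if ?X S e then 1 else 0)"
    by (rule sum.swap)
  also have "\<dots> = (\<Sum>e\<in>F. real (card {S \<in> C. ?X S e}))"
    using C by (simp add: sum.If_cases Int_def)
  also have "\<dots> = (\<Sum>e\<in>F. 2 * cluster_dist C e)"
    using assms(2,3) by (intro sum.cong card_crossing_clusters) auto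
  finally show ?thesis by (simp add: sum_distrib_left)
qed

text \<open>For a nonempty proper subset the sign compares the scaled cut with \<open>l\<close>. The
  division-free form also makes sense for \<open>S = V\<close>, where it is 0, and it is affine in
  \<open>l\<close>.\<close>

definition cut_excess :: "'a set \<Rightarrow> 'a set set \<Rightarrow> real \<Rightarrow> 'a set \<Rightarrow> real" where
  "cut_excess V E l S = real (cut V E S) - l * (real (card S) * real (card (V - S)))"

text \<open>Writing \<open>d\<close> for the distance, the non-edge cost \<open>l * (1 - d)\<close>
  splits into the constant \<open>l\<close> and \<open>- l * d\<close>. What remains is
  \<open>d\<close> summed over \<open>E\<close> minus \<open>l\<close> times \<open>d\<close> summed
  over all pairs, and double counting turns both sums into sums over clusters. The last term does
  not depend on \<open>C\<close>, so clusterings can be compared by their total excess.\<close>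

lemma lambda_cc_eq:
  assumes "simple_graph V E" "partition_on V C"
  shows "lambda_cc V E l C =
    (\<Sum>S\<in>C. cut_excess V E l S) / 2 + l * real (card (all_pairs V - E))"
proof -
  have fin: "finite V" and E: "E \<subseteq> all_pairs V"
    using assms(1) by (auto simp: simple_graph_def)
  have finP: "finite (all_pairs V)" using fin by (rule finite_all_pairs)
  let ?d = "cluster_dist C"
  have "(\<Sum>S\<in>C. real (card S) * real (card (V - S))) = (\<Sum>S\<in>C. real (cut V (all_pairs V) S))"
    by (intro sum.cong refl) (metis assms(2) cut_all_pairs of_nat_mult partition_onD1 Union_upper)
  then have "(\<Sum>S\<in>C. real (card S) * real (card (V - S))) = 2 * (\<Sum>e\<in>all_pairs V. ?d e)"
    using sum_cut_partition[OF fin assms(2) order_refl] by simp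
  then have "(\<Sum>S\<in>C. cut_excess V E l S) = 2 * (\<Sum>e\<in>E. ?d e) - l * (2 * (\<Sum>e\<in>all_pairs V. ?d e))"
    unfolding cut_excess_def sum_subtractf sum_distrib_left[symmetric]
    using sum_cut_partition[OF fin assms(2) E] by simp
  moreover have "(\<Sum>e\<in>all_pairs V. ?d e) = (\<Sum>e\<in>all_pairs V - E. ?d e) + (\<Sum>e\<in>E. ?d e)"
    by (rule sum.subset_diff[OF E finP])
  ultimately show ?thesis
    unfolding lambda_cc_def
    by (simp add: sum_distrib_left[symmetric] sum_subtractf algebra_simps)
qed

lemma lambda_cc_optimal_iff:
  assumes "simple_graph V E"
  shows "lambda_cc_optimal V E l C \<longleftrightarrow> partition_on V C \<and>
    (\<forall>D. partition_on V D \<longrightarrow> (\<Sum>S\<in>C. cut_excess V E l S) \<le> (\<Sum>S\<in>D. cut_excess V E l S))"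
  unfolding lambda_cc_optimal_def using lambda_cc_eq[OF assms] by auto

text \<open>A finite set has finitely many partitions. Existence keeps the later claims about all
  optimal clusterings from being vacuous.\<close>

lemma ex_lambda_cc_optimal:
  assumes "finite V" "V \<noteq> {}"
  shows "\<exists>C. lambda_cc_optimal V E l C"
proof -
  have "{V} \<in> {P. partition_on V P}" using assms(2) by (simp add: partition_on_space)
  then have "{P. partition_on V P} \<noteq> {}" by blast
  from ex_is_arg_min_if_finite[OF finitely_many_partition_on[OF assms(1)] this, of "lambda_cc V E l"]
  show ?thesis
    unfolding lambda_cc_optimal_def is_arg_min_linorder by auto
qed

section \<open>The sign of the excess and minimum scaled cuts\<close>

lemma cut_excess_whole [simp]: "cut_excess V E l V = 0"
  by (simp add: cut_excess_def cut_def cut_between_def)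

lemma cut_compl: "S \<subseteq> V \<Longrightarrow> cut V E (V - S) = cut V E S"
  unfolding cut_def by (subst cut_between_commute) (simp add: double_diff)

lemma cut_excess_compl: "S \<subseteq> V \<Longrightarrow> cut_excess V E l (V - S) = cut_excess V E l S"
  by (simp add: cut_excess_def cut_compl double_diff)

lemma card_mult_card_compl_pos:
  assumes "finite V" "S \<noteq> {}" "S \<subset> V"
  shows "0 < real (card S) * real (card (V - S))"
proof -
  have "finite S" "V - S \<noteq> {}" using assms by (auto intro: finite_subset)
  then show ?thesis using assms by (simp add: card_gt_0_iff)
qed

lemma cut_excess_conv_scaled_cut:
  assumes "finite V" "S \<noteq> {}" "S \<subset> V"
  shows "cut_excess V E l S = (scaled_cut V E S - l) * (real (card S) * real (card (V - S)))"
proof -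
  have "real (card S) * real (card (V - S)) \<noteq> 0"
    using card_mult_card_compl_pos[OF assms] by linarith
  then show ?thesis
    unfolding cut_excess_def scaled_cut_def left_diff_distrib by (metis nonzero_divide_eq_eq)
qed

lemma finite_proper_subsets: "finite V \<Longrightarrow> finite {S. S \<noteq> {} \<and> S \<subset> V}"
  by (rule finite_subset[of _ "Pow V"]) auto

lemma min_scaled_cut_le:
  assumes "finite V" "S \<noteq> {}" "S \<subset> V"
  shows "min_scaled_cut V E \<le> scaled_cut V E S"
  unfolding min_scaled_cut_def using assms finite_proper_subsets by (intro Min_le) auto

lemma ex_is_min_scaled_cut:
  assumes "2 \<le> card V"
  shows "\<exists>S. is_min_scaled_cut V E S"
proof -
  have fin: "finite V" using assms by (metis card.infinite not_numeral_le_zero)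
  have "V \<noteq> {}" using assms by auto
  then obtain x where x: "x \<in> V" by blast
  have "{x} \<noteq> V" using assms by auto
  with x have "{x} \<in> {S. S \<noteq> {} \<and> S \<subset> V}" by blast
  then have "{S. S \<noteq> {} \<and> S \<subset> V} \<noteq> {}" by blast
  then have "min_scaled_cut V E \<in> scaled_cut V E ` {S. S \<noteq> {} \<and> S \<subset> V}"
    unfolding min_scaled_cut_def
    by (intro Min_in finite_imageI finite_proper_subsets fin) blast
  then obtain S where "S \<noteq> {}" "S \<subset> V" "min_scaled_cut V E = scaled_cut V E S" by blast
  then show ?thesis unfolding is_min_scaled_cut_def by metis
qed

lemma min_scaled_cut_nonneg:
  assumes "2 \<le> card V"
  shows "0 \<le> min_scaled_cut V E"
proof -
  obtain S where "scaled_cut V E S = min_scaled_cut V E"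
    using ex_is_min_scaled_cut[OF assms, of E] by (auto simp: is_min_scaled_cut_def)
  moreover have "0 \<le> scaled_cut V E S" by (simp add: scaled_cut_def)
  ultimately show ?thesis by simp
qed

lemma cut_excess_nonneg:
  assumes "finite V" "S \<noteq> {}" "S \<subseteq> V" "l \<le> min_scaled_cut V E"
  shows "0 \<le> cut_excess V E l S"
proof (cases "S = V")
  case False
  then have S: "S \<subset> V" using assms by auto
  show ?thesis
    using cut_excess_conv_scaled_cut[OF assms(1,2) S, of E l]
      card_mult_card_compl_pos[OF assms(1,2) S] min_scaled_cut_le[OF assms(1,2) S, of E] assms(4)
    by simp
qed simp

lemma partition_on_compl_pair:
  "S \<noteq> {} \<Longrightarrow> S \<subset> V \<Longrightarrow> partition_on V {S, V - S}"
  by (auto simp: partition_on_def disjoint_def)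

lemma sum_compl_pair:
  assumes "S \<noteq> {}" "S \<subset> V"
  shows "(\<Sum>T\<in>{S, V - S}. cut_excess V E l T) = 2 * cut_excess V E l S"
proof -
  \<comment> \<open>Otherwise the set \<open>{S, V - S}\<close> would be a singleton and the excess
    would be counted only once.\<close>
  have "S \<noteq> V - S" using assms by auto
  then show ?thesis using assms by (simp add: cut_excess_compl)
qed

text \<open>The witness is a minimum cut together with its complement: both have the same excess,
  negative for \<open>l\<close> above the minimum.\<close>

lemma sum_cut_excess_neg:
  assumes "2 \<le> card V" "min_scaled_cut V E < l"
  obtains D where "partition_on V D" "(\<Sum>S\<in>D. cut_excess V E l S) < 0"
proof -
  have fin: "finite V" using assms by (metis card.infinite not_numeral_le_zero)
  obtain S where S: "S \<noteq> {}" "S \<subset> V" "scaled_cut V E S = min_scaled_cut V E"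
    using ex_is_min_scaled_cut[OF assms(1), of E] by (auto simp: is_min_scaled_cut_def)
  have "cut_excess V E l S < 0"
    using cut_excess_conv_scaled_cut[OF fin S(1,2), of E l] card_mult_card_compl_pos[OF fin S(1,2)]
      S(3) assms(2) by (simp add: mult_neg_pos)
  then show ?thesis
    using that[OF partition_on_compl_pair[OF S(1,2)]] sum_compl_pair[OF S(1,2), of E l] by simp
qed

lemma optimal_cut_excess_neg:
  assumes "simple_graph V E" "2 \<le> card V" "min_scaled_cut V E < l" "lambda_cc_optimal V E l C"
  shows "(\<Sum>S\<in>C. cut_excess V E l S) < 0"
  using sum_cut_excess_neg[OF assms(2,3)] assms(4)
  unfolding lambda_cc_optimal_iff[OF assms(1)] by (metis order_le_less_trans)

section \<open>Partitions and the effect of merging two clusters\<close>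

lemma partition_on_eq_whole:
  assumes "partition_on V C" "V \<in> C"
  shows "C = {V}"
proof -
  have "S = V" if "S \<in> C" for S
  proof (rule ccontr)
    assume "S \<noteq> V"
    then have "S \<inter> V = {}"
      using partition_onD2[OF assms(1)] assms(2) that by (meson disjointD)
    moreover have "S \<subseteq> V" using partition_onD1[OF assms(1)] that by blast
    ultimately have "S = {}" by blast
    then show False using partition_onD3[OF assms(1)] that by blast
  qed
  then show ?thesis using assms(2) by blast
qed

lemma partition_on_proper:
  assumes "partition_on V C" "C \<noteq> {V}" "S \<in> C"
  shows "S \<noteq> {} \<and> S \<subset> V"
  using assms partition_on_eq_whole[OF assms(1)] partition_onD1[OF assms(1)]
    partition_onD3[OF assms(1)] by blast

lemma partition_on_card_ge_2:
  assumes "finite V" "V \<noteq> {}" "partition_on V C" "C \<noteq> {V}"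
  shows "2 \<le> card C"
proof (rule ccontr)
  assume "\<not> 2 \<le> card C"
  then have "card C = 0 \<or> card C = 1" by linarith
  moreover have "finite C" using assms(1,3) by (rule finite_elements)
  ultimately consider "C = {}" | S where "C = {S}"
    by (metis card_0_eq card_1_singletonE)
  then show False
    using assms(2,4) partition_onD1[OF assms(3)] by cases simp_all
qed

text \<open>An edge between \<open>S\<close> and \<open>T\<close> lies on both boundaries and on
  neither after the merge, hence the factor 2.\<close>

lemma cut_excess_Un:
  assumes "simple_graph V E" "S \<subseteq> V" "T \<subseteq> V" "S \<inter> T = {}"
  shows "cut_excess V E l (S \<union> T) = cut_excess V E l S + cut_excess V E l T
    - 2 * (real (cut_between E S T) - l * (real (card S) * real (card T)))"
proof -
  have fin: "finite V" and E: "E \<subseteq> all_pairs V"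
    using assms(1) by (auto simp: simple_graph_def)
  \<comment> \<open>Used for \<open>F = E\<close> and, to handle the products of cardinalities, for
    \<open>F = all_pairs V\<close>.\<close>
  have cut_Un: "cut V F (S \<union> T) + 2 * cut_between F S T = cut V F S + cut V F T"
    if "F \<subseteq> all_pairs V" for F
  proof -
    have F: "finite F" using that fin finite_all_pairs finite_subset by blast
    let ?R = "V - (S \<union> T)"
    have "V - S = T \<union> ?R" "V - T = S \<union> ?R" using assms by auto
    moreover have "S \<inter> T = {}" "T \<inter> S = {}" "T \<inter> ?R = {}" "S \<inter> ?R = {}" using assms(4) by auto
    ultimately have "cut V F S = cut_between F S T + cut_between F S ?R"
      "cut V F T = cut_between F T S + cut_between F T ?R"
      unfolding cut_def by (simp_all only: cut_between_Un_right[OF F])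
    moreover have "cut V F (S \<union> T) = cut_between F S ?R + cut_between F T ?R"
      unfolding cut_def cut_between_commute[of F _ ?R]
      using assms(4) by (intro cut_between_Un_right[OF F]) auto
    ultimately show ?thesis by (simp add: cut_between_commute[of F T S])
  qed
  have "card (S \<union> T) * card (V - (S \<union> T)) + 2 * (card S * card T)
      = card S * card (V - S) + card T * card (V - T)"
    using cut_Un[OF order_refl] assms by (simp add: cut_all_pairs cut_between_all_pairs)
  then have prod: "real (card (S \<union> T)) * real (card (V - (S \<union> T)))
      = real (card S) * real (card (V - S)) + real (card T) * real (card (V - T))
        - 2 * (real (card S) * real (card T))"
    by (simp add: algebra_simps flip: of_nat_mult of_nat_add)
  have cut: "real (cut V E (S \<union> T)) = real (cut V E S) + real (cut V E T) - 2 * real (cut_between E S T)"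
    using cut_Un[OF E] by linarith
  show ?thesis
    unfolding cut_excess_def prod cut by (simp add: algebra_simps)
qed

text \<open>The complement of \<open>S\<close> is the disjoint union of the other clusters, so both
  the cut and the product split into pairwise terms. They are the same terms that govern the gain
  from a merge.\<close>

lemma cut_excess_partition:
  assumes "simple_graph V E" "partition_on V C" "S \<in> C"
  shows "cut_excess V E l S =
    (\<Sum>T\<in>C - {S}. real (cut_between E S T) - l * (real (card S) * real (card T)))"
proof -
  have fin: "finite V" and E: "E \<subseteq> all_pairs V"
    using assms(1) by (auto simp: simple_graph_def)
  have disj: "S \<inter> T = {}" if "T \<in> C - {S}" for T
    using assms(2,3) that by (auto simp: partition_on_def disjoint_def)
  have "\<Union>(C - {S}) = V - S" using assms(2,3) disj by (auto simp: partition_on_def)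
  moreover have "finite (C - {S})" using finite_elements[OF fin assms(2)] by simp
  moreover have "disjoint (C - {S})" using assms(2) by (auto simp: partition_on_def disjoint_def)
  ultimately have sum_cut: "cut V F S = (\<Sum>T\<in>C - {S}. cut_between F S T)" if "F \<subseteq> all_pairs V" for F
    unfolding cut_def
    using cut_between_Union_right[of F "C - {S}" S] disj that fin finite_all_pairs finite_subset by metis
  have sub: "T \<subseteq> V" if "T \<in> C" for T using assms(2) that by (auto simp: partition_on_def)
  have "card S * card (V - S) = (\<Sum>T\<in>C - {S}. cut_between (all_pairs V) S T)"
    using sum_cut[OF order_refl] sub[OF assms(3)] by (simp add: cut_all_pairs)
  also have "\<dots> = (\<Sum>T\<in>C - {S}. card S * card T)"
    using sub assms(3) disj by (intro sum.cong refl cut_between_all_pairs) auto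
  finally have "real (card S) * real (card (V - S)) = (\<Sum>T\<in>C - {S}. real (card S) * real (card T))"
    by (simp flip: of_nat_mult of_nat_sum)
  then show ?thesis
    unfolding cut_excess_def sum_cut[OF E] sum_subtractf sum_distrib_left[symmetric] by simp
qed

text \<open>The second conclusion ensures that the merged cluster contributes its own summand to a
  sum over the new partition.\<close>

lemma partition_on_merge:
  assumes "partition_on V C" "S \<in> C" "T \<in> C" "S \<noteq> T"
  shows "partition_on V (insert (S \<union> T) (C - {S, T}))" "S \<union> T \<notin> C - {S, T}"
proof -
  have disj: "A \<inter> B = {}" if "A \<in> C" "B \<in> C" "A \<noteq> B" for A B
    using assms(1) that by (auto simp: partition_on_def disjoint_def)
  show "partition_on V (insert (S \<union> T) (C - {S, T}))"
  proof (rule partition_onI)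
    show "\<Union>(insert (S \<union> T) (C - {S, T})) = V"
      using assms by (auto simp: partition_on_def)
    show "{} \<notin> insert (S \<union> T) (C - {S, T})"
      using assms by (auto simp: partition_on_def)
    show "disjnt p q"
      if "p \<in> insert (S \<union> T) (C - {S, T})" "q \<in> insert (S \<union> T) (C - {S, T})" "p \<noteq> q" for p q
      using that assms(2,3) disj by (auto simp: disjnt_def)
  qed
  have "S \<noteq> {}" using assms by (auto simp: partition_on_def)
  then show "S \<union> T \<notin> C - {S, T}" using assms(2) disj[of S "S \<union> T"] by auto
qed

lemma optimal_cut_excess_nonpos:
  assumes G: "simple_graph V E" and opt: "lambda_cc_optimal V E l C" and S: "S \<in> C"
  shows "cut_excess V E l S \<le> 0"
proof (rule ccontr)
  assume pos: "\<not> cut_excess V E l S \<le> 0"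
  have C: "partition_on V C" using opt by (simp add: lambda_cc_optimal_def)
  let ?h = "\<lambda>T. real (cut_between E S T) - l * (real (card S) * real (card T))"
  \<comment> \<open>A positive sum has a positive term; its index \<open>T\<close> is the cluster to
    merge with \<open>S\<close>.\<close>
  have "\<exists>T\<in>C - {S}. 0 < ?h T"
  proof (rule ccontr)
    assume "\<not> (\<exists>T\<in>C - {S}. 0 < ?h T)"
    then have "sum ?h (C - {S}) \<le> 0" by (intro sum_nonpos) (simp add: not_less)
    then show False using pos cut_excess_partition[OF G C S, of l] by simp
  qed
  then obtain T where T: "T \<in> C" "T \<noteq> S" "0 < ?h T" by blast
  let ?D = "C - {S, T}"
  have fin: "finite C" using finite_elements[OF _ C] G by (simp add: simple_graph_def)
  have sub: "S \<subseteq> V" "T \<subseteq> V" "S \<inter> T = {}"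
    using partition_onD1[OF C] disjointD[OF partition_onD2[OF C] S T(1)] S T(1,2) by auto
  note merge = partition_on_merge[OF C S T(1) T(2)[symmetric]]
  let ?f = "cut_excess V E l"
  have "C = insert S (insert T ?D)" using S T(1) by blast
  then have "sum ?f C = sum ?f (insert S (insert T ?D))" by (rule arg_cong)
  then have sum_C: "sum ?f C = ?f S + ?f T + sum ?f ?D" using fin T(2) by simp
  have sum_merge: "sum ?f (insert (S \<union> T) ?D) = ?f (S \<union> T) + sum ?f ?D"
    using fin by (intro sum.insert merge(2)) simp
  \<comment> \<open>The merge lowers the sum by exactly \<open>2 * ?h T\<close>.\<close>
  have "sum ?f (insert (S \<union> T) ?D) < sum ?f C"
    unfolding sum_C sum_merge cut_excess_Un[OF G sub] using T(3) by simp
  moreover have "sum ?f C \<le> sum ?f (insert (S \<union> T) ?D)"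
    using opt merge(1) unfolding lambda_cc_optimal_iff[OF G] by blast
  ultimately show False by linarith
qed

section \<open>Optimal clusterings above and below the minimum scaled cut\<close>

lemma optimal_above_min_scaled_cut:
  assumes "simple_graph V E" "2 \<le> card V" "min_scaled_cut V E < l" "lambda_cc_optimal V E l C"
  shows "2 \<le> card C" "S \<in> C \<Longrightarrow> scaled_cut V E S \<le> l"
proof -
  have fin: "finite V" using assms by (simp add: simple_graph_def)
  have "V \<noteq> {}" using assms(2) by auto
  have C: "partition_on V C" using assms(4) by (simp add: lambda_cc_optimal_def)
  \<comment> \<open>The single cluster has total excess 0, while the optimum is negative.\<close>
  have "C \<noteq> {V}" using optimal_cut_excess_neg[OF assms] by auto
  with fin \<open>V \<noteq> {}\<close> C show "2 \<le> card C" by (rule partition_on_card_ge_2)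
  assume S: "S \<in> C"
  then have "S \<noteq> {}" "S \<subset> V"
    using partition_on_proper[OF C \<open>C \<noteq> {V}\<close>] by blast+
  note S_pos = card_mult_card_compl_pos[OF fin this] and S_eq = cut_excess_conv_scaled_cut[OF fin this]
  have "(scaled_cut V E S - l) * (real (card S) * real (card (V - S))) \<le> 0"
    using optimal_cut_excess_nonpos[OF assms(1,4) S] S_eq by metis
  then have "scaled_cut V E S - l \<le> 0"
    using mult_pos_pos[OF _ S_pos] by (meson not_le)
  then show "scaled_cut V E S \<le> l" by simp
qed

lemma single_cluster_optimal:
  assumes "simple_graph V E" "V \<noteq> {}" "l \<le> min_scaled_cut V E"
  shows "lambda_cc_optimal V E l {V}"
  unfolding lambda_cc_optimal_iff[OF assms(1)]
  using assms by (auto simp: partition_on_space simple_graph_def partition_on_def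
      intro!: sum_nonneg cut_excess_nonneg)

section \<open>Resolution parameters just above the minimum scaled cut\<close>

lemma all_min_scaled_cut_if_zero:
  assumes "finite V" "partition_on V P" "P \<noteq> {V}"
    "(\<Sum>S\<in>P. cut_excess V E (min_scaled_cut V E) S) \<le> 0" "S \<in> P"
  shows "is_min_scaled_cut V E S"
proof -
  let ?f = "cut_excess V E (min_scaled_cut V E)"
  have nonneg: "0 \<le> ?f T" if "T \<in> P" for T
    using assms(1,2) that by (intro cut_excess_nonneg) (auto simp: partition_on_def)
  \<comment> \<open>At the minimum no summand is negative, so a nonpositive total forces every
    summand to vanish.\<close>
  have "sum ?f P = 0" using assms(4) nonneg by (meson sum_nonneg antisym)
  then have "?f S = 0"
    using sum_nonneg_eq_0_iff[OF finite_elements[OF assms(1,2)] nonneg] assms(5) by auto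
  moreover have S: "S \<noteq> {}" "S \<subset> V"
    using partition_on_proper[OF assms(2,3,5)] by blast+
  ultimately have "scaled_cut V E S - min_scaled_cut V E = 0"
    using card_mult_card_compl_pos[OF assms(1) S] cut_excess_conv_scaled_cut[OF assms(1) S]
    by (metis less_irrefl mult_eq_0_iff)
  then show ?thesis
    using S by (simp add: is_min_scaled_cut_def)
qed

lemma ex_resolution_min_cut_optimal:
  assumes G: "simple_graph V E" and card: "2 \<le> card V" and lt1: "min_scaled_cut V E < 1"
    and no3: "\<not> (\<exists>P. partition_on V P \<and> 3 \<le> card P \<and> (\<forall>S\<in>P. is_min_scaled_cut V E S))"
  shows "\<exists>l. min_scaled_cut V E < l \<and> l < 1 \<and>
    (\<forall>C. lambda_cc_optimal V E l C \<longrightarrow> (\<exists>S. is_min_scaled_cut V E S \<and> C = {S, V - S}))"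
proof -
  let ?m = "min_scaled_cut V E"
  let ?g = "\<lambda>l P. \<Sum>S\<in>P. cut_excess V E l S"
  have fin: "finite V" using G by (simp add: simple_graph_def)
  \<comment> \<open>These are the partitions to be kept from being optimal. Their total excess is
    continuous in \<open>l\<close>, so it stays positive slightly to the right of \<open>?m\<close>;
    finitely many such conditions, and \<open>l < 1\<close>, hold for a common
    \<open>l\<close>.\<close>
  let ?Q = "{P. partition_on V P \<and> 0 < ?g ?m P}"
  have "finite ?Q" using finitely_many_partition_on[OF fin] by (rule rev_finite_subset) auto
  moreover have "\<forall>\<^sub>F l in at_right ?m. 0 < ?g l P" if "P \<in> ?Q" for P
  proof -
    have "((\<lambda>l. ?g l P) \<longlongrightarrow> ?g ?m P) (at_right ?m)"
      unfolding cut_excess_def by (intro tendsto_intros)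
    then show ?thesis using that by (intro order_tendstoD(1)[of _ "?g ?m P"]) auto
  qed
  ultimately have "\<forall>\<^sub>F l in at_right ?m. \<forall>P\<in>?Q. 0 < ?g l P"
    by (intro eventually_ball_finite) blast+
  moreover have "\<forall>\<^sub>F l in at_right ?m. l \<in> {?m<..<1}"
    using lt1 by (rule eventually_at_right_real)
  ultimately obtain l where l: "?m < l" "l < 1" "\<And>P. P \<in> ?Q \<Longrightarrow> 0 < ?g l P"
    using eventually_happens'[OF trivial_limit_at_right_real eventually_conj] by fastforce
  have "\<exists>S. is_min_scaled_cut V E S \<and> C = {S, V - S}" if opt: "lambda_cc_optimal V E l C" for C
  proof -
    have C: "partition_on V C" using opt by (simp add: lambda_cc_optimal_def)
    have neg: "?g l C < 0" by (rule optimal_cut_excess_neg[OF G card l(1) opt])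
    then have "C \<noteq> {V}" by auto
    \<comment> \<open>Otherwise \<open>C\<close> would belong to \<open>?Q\<close> and its sum at
      \<open>l\<close> would be positive, contradicting \<open>neg\<close>.\<close>
    have "?g ?m C \<le> 0" using neg l(3)[of C] C by force
    then have min: "is_min_scaled_cut V E S" if "S \<in> C" for S
      using all_min_scaled_cut_if_zero[OF fin C \<open>C \<noteq> {V}\<close>] that by blast
    \<comment> \<open>All clusters are minimum cuts, so \<open>no3\<close> leaves at most two of
      them; optimality above the minimum gives at least two.\<close>
    with no3 C have "card C = 2"
      using optimal_above_min_scaled_cut(1)[OF G card l(1) opt] by (metis Suc_1 eval_nat_numeral(3) le_antisym not_less_eq_eq)
    then obtain S T where ST: "C = {S, T}" "S \<noteq> T" by (auto simp: card_2_iff)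
    then have "T = V - S" using C by (auto simp: partition_on_def disjoint_def)
    then show ?thesis using ST min by auto
  qed
  with l show ?thesis by blast
qed

text \<open>The two conditions on the existence of \<open>l'\<close> exclude genuine failures. In a
  complete graph the minimum scaled cut is 1, which leaves no admissible parameter above it. In the
  edgeless graph on three nodes the singletons are the only optimum for every \<open>l\<close> in
  (0,1), so no two-cluster partition is ever optimal.\<close>

theorem theorem2:
  fixes V :: "'a set" and E :: "'a set set"
  assumes "simple_graph V E" and "2 \<le> card V"
  shows "(\<forall>l. 0 < l \<and> l < 1 \<and> min_scaled_cut V E < l \<longrightarrow>
            (\<exists>C. lambda_cc_optimal V E l C) \<and>
            (\<forall>C. lambda_cc_optimal V E l C \<longrightarrow>
               2 \<le> card C \<and> (\<forall>S\<in>C. scaled_cut V E S \<le> l)))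
       \<and> (min_scaled_cut V E < 1 \<and>
          \<not> (\<exists>P. partition_on V P \<and> 3 \<le> card P \<and> (\<forall>S\<in>P. is_min_scaled_cut V E S)) \<longrightarrow>
          (\<exists>l'. 0 < l' \<and> l' < 1 \<and> min_scaled_cut V E < l' \<and>
            (\<exists>S. is_min_scaled_cut V E S \<and> lambda_cc_optimal V E l' {S, V - S}) \<and>
            (\<forall>C. lambda_cc_optimal V E l' C \<longrightarrow>
               (\<exists>S. is_min_scaled_cut V E S \<and> C = {S, V - S}))))
       \<and> (\<forall>l. 0 < l \<and> l < 1 \<and> l \<le> min_scaled_cut V E \<longrightarrow>
            lambda_cc_optimal V E l {V})"
proof (intro conjI allI impI)
  have "finite V" "V \<noteq> {}" using assms by (auto simp: simple_graph_def)
  note ex = ex_lambda_cc_optimal[OF this]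
  show "\<exists>C. lambda_cc_optimal V E l C" for l by (rule ex)
  show "2 \<le> card C" "\<forall>S\<in>C. scaled_cut V E S \<le> l"
    if "0 < l \<and> l < 1 \<and> min_scaled_cut V E < l" "lambda_cc_optimal V E l C" for l C
    using optimal_above_min_scaled_cut[OF assms _ that(2)] that(1) by auto
  show "lambda_cc_optimal V E l {V}" if "0 < l \<and> l < 1 \<and> l \<le> min_scaled_cut V E" for l
    using single_cluster_optimal[OF assms(1) \<open>V \<noteq> {}\<close>] that by blast
  assume "min_scaled_cut V E < 1 \<and>
    \<not> (\<exists>P. partition_on V P \<and> 3 \<le> card P \<and> (\<forall>S\<in>P. is_min_scaled_cut V E S))"
  then obtain l where l: "min_scaled_cut V E < l" "l < 1"
      "\<And>C. lambda_cc_optimal V E l C \<Longrightarrow> \<exists>S. is_min_scaled_cut V E S \<and> C = {S, V - S}"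
    using ex_resolution_min_cut_optimal[OF assms] by blast
  moreover have "0 < l" using l(1) min_scaled_cut_nonneg[OF assms(2), of E] by linarith
  moreover obtain C where "lambda_cc_optimal V E l C" using ex by blast
  ultimately show "\<exists>l'. 0 < l' \<and> l' < 1 \<and> min_scaled_cut V E < l' \<and>
      (\<exists>S. is_min_scaled_cut V E S \<and> lambda_cc_optimal V E l' {S, V - S}) \<and>
      (\<forall>C. lambda_cc_optimal V E l' C \<longrightarrow> (\<exists>S. is_min_scaled_cut V E S \<and> C = {S, V - S}))"
    by blast
qed

end
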